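(* An S-minimal tetrahedral curve is arithmetically Cohen-Macaulay if and only if it is trivial.
   Context: Let $k$ be a field and $R=k[a,b,c,d]$. For integers $a_1,\dots,a_6\ge0$, the tetrahedral curve $(a_1,\dots,a_6)$ is the subscheme $C$ of $\mathbb P^3$ with saturated ideal $I_C=(a,b)^{a_1}\cap(a,c)^{a_2}\cap(a,d)^{a_3}\cap(b,c)^{a_4}\cap(b,d)^{a_5}\cap(c,d)^{a_6}$. The trivial curve is $(0,\dots,0)$, with ideal $R$; it is regarded as arithmetically Cohen-Macaulay. A non-trivial curve $C$ is arithmetically Cohen-Macaulay if $R/I_C$ is Cohen-Macaulay, equivalently $H^1(\mathbb P^3,\mathcal I_C(t))=0$ for all $t\in\mathbb Z$. S-minimality. For a non-trivial tetrahedral curve consider the systems (A): $a_1+a_2\ge a_4$, $a_1+a_3\ge a_5$, $a_2+a_3\ge a_6$; (B): $a_1+a_4\ge a_2$, $a_1+a_5\ge a_3$, $a_4+a_5\ge a_6$; (C): $a_2+a_4\ge a_1$, $a_2+a_6\ge a_3$, $a_4+a_6\ge a_5$; (D): $a_3+a_5\ge a_1$, $a_3+a_6\ge a_2$, $a_5+a_6\ge a_4$. A tetrahedral curve is S-minimal if it is trivial or none of the systems (A), (B), (C), (D) holds. *)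

theory Defs
  imports
    "HOL-Algebra.Algebra"
    "HOL-Algebra.Algebraic_Closure_Type"
    "HOL-Library.Poly_Mapping"
    "HOL-Library.Extended_Nat"
begin

subsection \<open>Cohen-Macaulay rings\<close>

text \<open>A regular sequence \<open>x\<^sub>0, \<dots>, x\<^sub>n\<^sub>-\<^sub>1\<close>: it generates a proper ideal, and each \<open>x\<^sub>i\<close> is a
  non-zero-divisor on \<open>A/(x\<^sub>0, \<dots>, x\<^sub>i\<^sub>-\<^sub>1)\<close>.\<close>

definition regular_sequence :: "('a, 'b) ring_scheme \<Rightarrow> 'a list \<Rightarrow> bool" where
  "regular_sequence A xs \<longleftrightarrow>
     set xs \<subseteq> carrier A \<and>
     Idl\<^bsub>A\<^esub> (set xs) \<noteq> carrier A \<and>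
     (\<forall>i < length xs. \<forall>y \<in> carrier A.
        xs ! i \<otimes>\<^bsub>A\<^esub> y \<in> Idl\<^bsub>A\<^esub> (set (take i xs)) \<longrightarrow> y \<in> Idl\<^bsub>A\<^esub> (set (take i xs)))"

definition ideal_depth :: "('a, 'b) ring_scheme \<Rightarrow> 'a set \<Rightarrow> enat" where
  "ideal_depth A I = Sup {enat (length xs) | xs. regular_sequence A xs \<and> set xs \<subseteq> I}"

definition codimension :: "('a, 'b) ring_scheme \<Rightarrow> 'a set \<Rightarrow> enat" where
  "codimension A P =
     Sup {enat n | n. \<exists>p :: nat \<Rightarrow> 'a set.
       (\<forall>i \<le> n. primeideal (p i) A) \<and> (\<forall>i < n. p i \<subset> p (Suc i)) \<and> p n = P}"

text \<open>This is the definition in Eisenbud, Commutative Algebra, Section 18.2. It avoids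
  localizations: for a maximal ideal \<open>P\<close> of a Noetherian ring, \<open>ideal_depth A P\<close> and
  \<open>codimension A P\<close> are the depth and the Krull dimension of the local ring \<open>A\<^sub>P\<close>.\<close>

definition cohen_macaulay :: "('a, 'b) ring_scheme \<Rightarrow> bool" where
  "cohen_macaulay A \<longleftrightarrow>
     cring A \<and> noetherian_ring A \<and>
     (\<forall>P. maximalideal P A \<longrightarrow> ideal_depth A P = codimension A P)"


subsection \<open>Tetrahedral curves\<close>

datatype coord = coord_a | coord_b | coord_c | coord_d

text \<open>Exponent vectors are finitely supported functions \<open>coord \<Rightarrow>\<^sub>0 nat\<close>, so this is
  \<open>k[a,b,c,d]\<close>.\<close>

type_synonym 'k poly4 = "(coord \<Rightarrow>\<^sub>0 nat) \<Rightarrow>\<^sub>0 'k"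

definition var :: "coord \<Rightarrow> 'k::field poly4" where
  "var v = Poly_Mapping.single (Poly_Mapping.single v 1) 1"

abbreviation poly4_ring :: "'k::field poly4 ring" where
  "poly4_ring \<equiv> ring_of_type_algebra"

text \<open>\<open>edge_ideal u v n\<close> is \<open>(u, v)\<^sup>n\<close>; the power is taken with respect to the product of
  ideals, with \<open>(u, v)\<^sup>0 = R\<close>.\<close>

definition edge_ideal :: "coord \<Rightarrow> coord \<Rightarrow> nat \<Rightarrow> 'k::field poly4 set" where
  "edge_ideal u v n = (Idl\<^bsub>poly4_ring\<^esub> {var u, var v}) [^]\<^bsub>ideals_set poly4_ring\<^esub> n"

text \<open>A tetrahedral curve is given by its six multiplicities.\<close>

type_synonym tetrahedral_curve = "nat \<times> nat \<times> nat \<times> nat \<times> nat \<times> nat"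

fun curve_ideal :: "tetrahedral_curve \<Rightarrow> 'k::field poly4 set" where
  "curve_ideal (a1, a2, a3, a4, a5, a6) =
     edge_ideal coord_a coord_b a1 \<inter> edge_ideal coord_a coord_c a2 \<inter>
     edge_ideal coord_a coord_d a3 \<inter> edge_ideal coord_b coord_c a4 \<inter>
     edge_ideal coord_b coord_d a5 \<inter> edge_ideal coord_c coord_d a6"

definition trivial_curve :: "tetrahedral_curve \<Rightarrow> bool" where
  "trivial_curve C \<longleftrightarrow> C = (0, 0, 0, 0, 0, 0)"

definition arithmetically_CM :: "'k::field itself \<Rightarrow> tetrahedral_curve \<Rightarrow> bool" where
  "arithmetically_CM k C \<longleftrightarrow>
     trivial_curve C \<or> cohen_macaulay ((poly4_ring :: 'k poly4 ring) Quot curve_ideal C)"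

fun system_A :: "tetrahedral_curve \<Rightarrow> bool" where
  "system_A (a1, a2, a3, a4, a5, a6) \<longleftrightarrow> a1 + a2 \<ge> a4 \<and> a1 + a3 \<ge> a5 \<and> a2 + a3 \<ge> a6"

fun system_B :: "tetrahedral_curve \<Rightarrow> bool" where
  "system_B (a1, a2, a3, a4, a5, a6) \<longleftrightarrow> a1 + a4 \<ge> a2 \<and> a1 + a5 \<ge> a3 \<and> a4 + a5 \<ge> a6"

fun system_C :: "tetrahedral_curve \<Rightarrow> bool" where
  "system_C (a1, a2, a3, a4, a5, a6) \<longleftrightarrow> a2 + a4 \<ge> a1 \<and> a2 + a6 \<ge> a3 \<and> a4 + a6 \<ge> a5"

fun system_D :: "tetrahedral_curve \<Rightarrow> bool" where
  "system_D (a1, a2, a3, a4, a5, a6) \<longleftrightarrow> a3 + a5 \<ge> a1 \<and> a3 + a6 \<ge> a2 \<and> a5 + a6 \<ge> a4"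

definition S_minimal :: "tetrahedral_curve \<Rightarrow> bool" where
  "S_minimal C \<longleftrightarrow>
     trivial_curve C \<or> \<not> (system_A C \<or> system_B C \<or> system_C C \<or> system_D C)"

end

theory Submission
  imports Defs
begin

text \<open>Failure of the four systems forces one of the three pairs of opposite edges to consist of
  edges that are strictly longer than the sum of the other two edges in both triangles containing
  them. Say this pair is \<open>uv\<close>, \<open>xy\<close>. Then some monomial \<open>w\<close> lies in the ideals of the four other
  edges and misses \<open>(u,v)\<^sup>m\<close> and \<open>(x,y)\<^sup>n\<close> by exactly one degree. The element \<open>e\<close> that is \<open>w\<close>
  modulo \<open>(u,v)\<^sup>m\<close> and \<open>0\<close> modulo \<open>(x,y)\<^sup>n\<close> is not in \<open>R/I\<close>, but every multiple of it by a
  variable is: \<open>u e = v e = 0\<close>, \<open>x e = x w\<close>, \<open>y e = y w\<close>. Hence \<open>e\<close> represents a socle element of the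
  first local cohomology of \<open>R/I\<close>, so the depth at the irrelevant ideal is at most 1, while
  \<open>(u,v) \<subset> (u,v,x) \<subset> (u,v,x,y)\<close> shows that the codimension is at least 2.\<close>

section \<open>Ideals and regular sequences in a quotient ring\<close>

context cring
begin

lemma coset_eq_iff:
  assumes "ideal I R" "a \<in> carrier R" "b \<in> carrier R"
  shows "I +> a = I +> b \<longleftrightarrow> a \<ominus> b \<in> I"
  using quotient_eq_iff_same_a_r_cos[OF assms] by blast

text \<open>An ideal that contains \<open>I\<close> is a union of cosets of \<open>I\<close>, so
  membership can be tested on any representative. The passage of prime and maximal ideals to the
  quotient rests on this.\<close>

lemma coset_in_image_iff:
  assumes "ideal I R" "ideal J R" "I \<subseteq> J" "a \<in> carrier R"
  shows "I +> a \<in> (+>) I ` J \<longleftrightarrow> a \<in> J"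
proof
  interpret J: ideal J R by fact
  assume "I +> a \<in> (+>) I ` J"
  then obtain b where b: "b \<in> J" "I +> a = I +> b" by blast
  then have "a \<ominus> b \<in> J"
    using assms coset_eq_iff[of I a b] J.Icarr by blast
  then have "(a \<ominus> b) \<oplus> b \<in> J" using b by (intro J.a_closed)
  then show "a \<in> J" using assms b J.Icarr by (simp add: minus_eq a_assoc l_neg)
qed auto

lemma carrier_quot: "carrier (R Quot I) = (+>) I ` carrier R"
  by (auto simp: FactRing_def A_RCOSETS_def')

lemma primeideal_image_quot:
  assumes I: "ideal I R" and P: "primeideal P R" and "I \<subseteq> P"
  shows "primeideal ((+>) I ` P) (R Quot I)"
proof -
  interpret I: ideal I R by fact
  interpret P: primeideal P R by fact
  note mem = coset_in_image_iff[OF I P.is_ideal \<open>I \<subseteq> P\<close>]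
  show ?thesis
  proof (rule primeidealI)
    show "ideal ((+>) I ` P) (R Quot I)"
      using ring_ideal_imp_quot_ideal[OF I P.is_ideal] .
    show "cring (R Quot I)" using I.quotient_is_cring[OF is_cring] .
    show "carrier (R Quot I) \<noteq> (+>) I ` P"
      using mem[of \<one>] P.I_notcarr P.one_imp_carrier unfolding carrier_quot by auto
    fix a b assume "a \<in> carrier (R Quot I)" "b \<in> carrier (R Quot I)"
      and ab: "a \<otimes>\<^bsub>R Quot I\<^esub> b \<in> (+>) I ` P"
    then obtain r s where rs: "r \<in> carrier R" "a = I +> r" "s \<in> carrier R" "b = I +> s"
      unfolding carrier_quot by auto
    then have "I +> (r \<otimes> s) \<in> (+>) I ` P"
      using ab by (simp add: FactRing_def I.rcoset_mult_add)
    then have "r \<otimes> s \<in> P" using mem rs by blast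
    then show "a \<in> (+>) I ` P \<or> b \<in> (+>) I ` P"
      using P.I_prime rs by blast
  qed
qed

text \<open>An ideal \<open>J\<close> of the quotient above the image of \<open>M\<close> is the
  image of its own preimage \<open>?J\<close> in \<open>R\<close>. Since \<open>?J\<close> contains
  \<open>M\<close>, maximality of \<open>M\<close> leaves only the two extreme choices.\<close>

lemma maximalideal_image_quot:
  assumes I: "ideal I R" and M: "maximalideal M R" and "I \<subseteq> M"
  shows "maximalideal ((+>) I ` M) (R Quot I)"
proof -
  interpret I: ideal I R by fact
  interpret M: maximalideal M R by fact
  note mem = coset_in_image_iff[OF I M.is_ideal \<open>I \<subseteq> M\<close>]
  show ?thesis
  proof (rule maximalidealI)
    show "ideal ((+>) I ` M) (R Quot I)"
      using ring_ideal_imp_quot_ideal[OF I M.is_ideal] .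
    show "carrier (R Quot I) \<noteq> (+>) I ` M"
      using mem[of \<one>] M.I_notcarr M.one_imp_carrier unfolding carrier_quot by auto
    fix J assume J: "ideal J (R Quot I)" "(+>) I ` M \<subseteq> J" "J \<subseteq> carrier (R Quot I)"
    let ?J = "{r \<in> carrier R. I +> r \<in> J}"
    have "ideal ?J R"
      using ring_hom_ring.ideal_vimage[OF I.rcos_ring_hom_ring J(1)] .
    then have "?J = M \<or> ?J = carrier R"
      using J(2) M.Icarr by (intro M.I_maximal) auto
    moreover have "(+>) I ` ?J = J"
      using J(3) unfolding carrier_quot by auto
    ultimately show "J = (+>) I ` M \<or> J = carrier (R Quot I)"
      unfolding carrier_quot by (elim disjE) (simp_all only: simp_thms)
  qed
qed

text \<open>The regularity conditions for the first two terms, lifted to congruences modulo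
  \<open>I\<close> on representatives. In the quotient the empty set generates the zero ideal
  \<open>{I}\<close>, and the coset of \<open>f\<close> generates its own multiples.\<close>

lemma regular_sequence_quotD:
  assumes I: "ideal I R" and reg: "regular_sequence (R Quot I) ((I +> f) # (I +> g) # Z)"
    and f: "f \<in> carrier R" and g: "g \<in> carrier R"
  shows "\<And>h. \<lbrakk>h \<in> carrier R; f \<otimes> h \<in> I\<rbrakk> \<Longrightarrow> h \<in> I"
    and "\<And>h k. \<lbrakk>h \<in> carrier R; k \<in> carrier R; g \<otimes> h \<ominus> f \<otimes> k \<in> I\<rbrakk>
           \<Longrightarrow> \<exists>l \<in> carrier R. h \<ominus> f \<otimes> l \<in> I"
proof -
  interpret I: ideal I R by fact
  interpret A: cring "R Quot I" using I.quotient_is_cring[OF is_cring] .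
  have zero: "\<zero>\<^bsub>R Quot I\<^esub> = I" by (simp add: FactRing_def)
  have mult: "(I +> a) \<otimes>\<^bsub>R Quot I\<^esub> (I +> b) = I +> (a \<otimes> b)"
    if "a \<in> carrier R" "b \<in> carrier R" for a b
    using that by (simp add: FactRing_def I.rcoset_mult_add)
  have car: "I +> a \<in> carrier (R Quot I)" if "a \<in> carrier R" for a
    using that unfolding carrier_quot by blast
  have null: "I +> a = I \<longleftrightarrow> a \<in> I" if "a \<in> carrier R" for a
    using that I.rcos_const_imp_mem a_rcos_zero[OF I] by blast
  have idl0: "Idl\<^bsub>R Quot I\<^esub> {} = {I}"
    using A.genideal_minimal[OF A.zeroideal, of "{}"]
      additive_subgroup.zero_closed[OF ideal.axioms(1)[OF A.genideal_ideal[of "{}"]]] zero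
    by auto
  have idl1: "Idl\<^bsub>R Quot I\<^esub> {I +> f} = {(I +> l) \<otimes>\<^bsub>R Quot I\<^esub> (I +> f) | l. l \<in> carrier R}"
    using A.cgenideal_eq_genideal[OF car[OF f]] unfolding cgenideal_def carrier_quot by auto
  have reg: "y \<in> Idl\<^bsub>R Quot I\<^esub> (set (take i ((I +> f) # (I +> g) # Z)))"
    if "i < Suc (Suc (length Z))" "y \<in> carrier (R Quot I)"
      "((I +> f) # (I +> g) # Z) ! i \<otimes>\<^bsub>R Quot I\<^esub> y
         \<in> Idl\<^bsub>R Quot I\<^esub> (set (take i ((I +> f) # (I +> g) # Z)))" for i y
    using reg that unfolding regular_sequence_def by simp
  {
    fix h assume h: "h \<in> carrier R" "f \<otimes> h \<in> I"
    then have "I +> h \<in> Idl\<^bsub>R Quot I\<^esub> {}"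
      using reg[of 0 "I +> h"] f by (simp add: idl0 mult car null)
    then show "h \<in> I" using h null idl0 by simp
  next
    fix h k assume h: "h \<in> carrier R" "k \<in> carrier R" "g \<otimes> h \<ominus> f \<otimes> k \<in> I"
    then have "I +> (g \<otimes> h) = I +> (k \<otimes> f)"
      using f g by (simp add: coset_eq_iff[OF I] m_comm)
    then have "(I +> g) \<otimes>\<^bsub>R Quot I\<^esub> (I +> h) = (I +> k) \<otimes>\<^bsub>R Quot I\<^esub> (I +> f)"
      using h f g by (simp add: mult)
    then have "(I +> g) \<otimes>\<^bsub>R Quot I\<^esub> (I +> h) \<in> Idl\<^bsub>R Quot I\<^esub> {I +> f}"
      unfolding idl1 using h by blast
    then have "I +> h \<in> Idl\<^bsub>R Quot I\<^esub> {I +> f}"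
      using reg[of 1 "I +> h"] car[OF h(1)] by simp
    then obtain l where l: "l \<in> carrier R" "I +> h = I +> (l \<otimes> f)"
      unfolding idl1 using mult f by auto
    then have "h \<ominus> f \<otimes> l \<in> I"
      using h f coset_eq_iff[OF I, of h "l \<otimes> f"] by (simp add: m_comm)
    then show "\<exists>l \<in> carrier R. h \<ominus> f \<otimes> l \<in> I" using l by blast
  }
qed

end

section \<open>The polynomial ring and its monomial ideals\<close>

text \<open>The library proves that \<open>'a \<Rightarrow>\<^sub>0 'b\<close> has no zero divisors only for linearly ordered
  exponents, so \<open>coord\<close> needs some linear order; which one is irrelevant.\<close>

instantiation coord :: linorder
begin

fun coord_rank :: "coord \<Rightarrow> nat" where
  "coord_rank coord_a = 0"
| "coord_rank coord_b = 1"
| "coord_rank coord_c = 2"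
| "coord_rank coord_d = 3"

definition "x \<le> y \<longleftrightarrow> coord_rank x \<le> coord_rank y"
definition "x < y \<longleftrightarrow> coord_rank x < coord_rank y" for x y :: coord

instance
proof
  fix x y :: coord
  assume "x \<le> y" "y \<le> x"
  then show "x = y"
    unfolding less_eq_coord_def by (cases x; cases y) simp_all
qed (auto simp: less_eq_coord_def less_coord_def)

end

abbreviation lk :: "('a \<Rightarrow>\<^sub>0 'b::zero) \<Rightarrow> 'a \<Rightarrow> 'b" where
  "lk \<equiv> Poly_Mapping.lookup"

lemma poly4_ring_simps [simp]:
  "carrier poly4_ring = UNIV" "x \<otimes>\<^bsub>poly4_ring\<^esub> y = x * y" "\<one>\<^bsub>poly4_ring\<^esub> = 1"
  "x \<oplus>\<^bsub>poly4_ring\<^esub> y = x + y" "\<zero>\<^bsub>poly4_ring\<^esub> = 0"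
  by (simp_all add: ring_of_type_algebra_def)

lemma cring_poly4: "cring (poly4_ring :: 'k::field poly4 ring)"
  by (rule cring_from_type_algebra)

lemma poly4_uminus [simp]: "\<ominus>\<^bsub>poly4_ring\<^esub> y = - (y :: 'k::field poly4)"
proof -
  interpret cring "poly4_ring :: 'k poly4 ring" by (rule cring_poly4)
  show ?thesis by (rule minus_equality) auto
qed

lemma poly4_minus [simp]: "x \<ominus>\<^bsub>poly4_ring\<^esub> y = x - (y :: 'k::field poly4)"
  by (simp add: a_minus_def)

lemma ideal_poly4I:
  fixes I :: "'k::field poly4 set"
  assumes "0 \<in> I" "\<And>f g. f \<in> I \<Longrightarrow> g \<in> I \<Longrightarrow> f + g \<in> I" "\<And>f g. f \<in> I \<Longrightarrow> g * f \<in> I"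
  shows "ideal I poly4_ring"
proof -
  interpret cring "poly4_ring :: 'k poly4 ring" by (rule cring_poly4)
  have "- f \<in> I" if "f \<in> I" for f using assms(3)[OF that, of "-1"] by simp
  moreover have "inv\<^bsub>add_monoid poly4_ring\<^esub> f = - f" for f :: "'k poly4"
    using minus_equality[of "-f" f] by (simp add: a_inv_def)
  ultimately show ?thesis
    using assms by (intro idealI subgroup.intro) (auto simp: ring_axioms mult.commute)
qed

text \<open>For arbitrary \<open>P\<close> this is the \<open>k\<close>-span of the monomials whose
  exponents satisfy \<open>P\<close>. It is an ideal once \<open>P\<close> is stable under adding
  exponents; the span of a single monomial also has this form.\<close>

definition monomial_ideal :: "((coord \<Rightarrow>\<^sub>0 nat) \<Rightarrow> bool) \<Rightarrow> 'k::field poly4 set" where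
  "monomial_ideal P = {f. \<forall>t \<in> Poly_Mapping.keys f. P t}"

lemma monomial_idealI:
  "(\<And>t. lk f t \<noteq> 0 \<Longrightarrow> P t) \<Longrightarrow> f \<in> monomial_ideal P"
  by (simp add: monomial_ideal_def in_keys_iff)

lemma monomial_idealD: "f \<in> monomial_ideal P \<Longrightarrow> lk f t \<noteq> 0 \<Longrightarrow> P t"
  by (simp add: monomial_ideal_def in_keys_iff)

lemma mono_in_monomial_ideal: "P t \<Longrightarrow> Poly_Mapping.single t c \<in> monomial_ideal P"
  by (simp add: monomial_ideal_def)

lemma monomial_ideal_Int: "monomial_ideal P \<inter> monomial_ideal Q = monomial_ideal (\<lambda>t. P t \<and> Q t)"
  by (auto simp: monomial_ideal_def)

lemma monomial_ideal_mult:
  assumes "\<And>s t. P s \<Longrightarrow> Q t \<Longrightarrow> W (s + t)" "f \<in> monomial_ideal P" "g \<in> monomial_ideal Q"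
  shows "f * g \<in> monomial_ideal W"
  using keys_mult[of f g] assms unfolding monomial_ideal_def by fastforce

lemma monomial_ideal_add:
  "f \<in> monomial_ideal P \<Longrightarrow> g \<in> monomial_ideal P \<Longrightarrow> f + g \<in> monomial_ideal P"
  using keys_add[of f g] unfolding monomial_ideal_def by blast

lemma ideal_monomial_ideal:
  assumes "\<And>s t. P t \<Longrightarrow> P (s + t)"
  shows "ideal (monomial_ideal P :: 'k::field poly4 set) poly4_ring"
proof (rule ideal_poly4I)
  fix f g :: "'k poly4" assume "f \<in> monomial_ideal P"
  then show "g * f \<in> monomial_ideal P"
    by (intro monomial_ideal_mult[of "\<lambda>_. True" P]) (auto simp: assms monomial_ideal_def)
qed (simp_all add: monomial_ideal_add, simp add: monomial_ideal_def)

text \<open>A polynomial is the sum of its terms, so a property closed under sums need only be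
  checked on the terms that occur in \<open>f\<close>.\<close>

lemma poly_mapping_induct_terms:
  fixes f :: "'a \<Rightarrow>\<^sub>0 'b::comm_monoid_add"
  assumes "Q 0" "\<And>f g. Q f \<Longrightarrow> Q g \<Longrightarrow> Q (f + g)"
    and "\<And>t. lk f t \<noteq> 0 \<Longrightarrow> Q (Poly_Mapping.single t (lk f t))"
  shows "Q f"
proof -
  have "Q (\<Sum>t\<in>A. Poly_Mapping.single t (lk f t))" if "finite A" "A \<subseteq> Poly_Mapping.keys f" for A
    using that by (induction A) (auto simp: assms in_keys_iff)
  from this[of "Poly_Mapping.keys f"]
  have "Q (\<Sum>t\<in>Poly_Mapping.keys f. Poly_Mapping.single t (lk f t))" by simp
  also have "(\<Sum>t\<in>Poly_Mapping.keys f. Poly_Mapping.single t (lk f t)) = f"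
    by (rule poly_mapping_eqI)
      (simp add: lookup_sum lookup_single when_def sum.delta' in_keys_iff)
  finally show ?thesis .
qed

text \<open>Turns every edge ideal into a condition on exponents. In the induction, a term of degree
  at least \<open>Suc n\<close> in \<open>u\<close> and \<open>v\<close> is divisible by one of
  these variables, and the cofactor still has degree at least \<open>n\<close>.\<close>

lemma edge_ideal_eq:
  assumes "u \<noteq> v"
  shows "(edge_ideal u v n :: 'k::field poly4 set) = monomial_ideal (\<lambda>t. n \<le> lk t u + lk t v)"
proof (induction n)
  case 0
  then show ?case
    by (simp add: edge_ideal_def monomial_ideal_def ideals_set_def)
next
  case (Suc n)
  interpret cring "poly4_ring :: 'k poly4 ring" by (rule cring_poly4)
  let ?M = "\<lambda>n. monomial_ideal (\<lambda>t. n \<le> lk t u + lk t v) :: 'k poly4 set"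
  let ?E = "Idl\<^bsub>poly4_ring\<^esub> {var u, var v} :: 'k poly4 set"
  have ideal_M: "ideal (?M n) poly4_ring" for n
    by (rule ideal_monomial_ideal) (simp add: lookup_add)
  have E: "ideal ?E poly4_ring" by (rule genideal_ideal) simp
  have "?E \<subseteq> ?M 1"
    by (rule genideal_minimal[OF ideal_M])
      (simp add: var_def mono_in_monomial_ideal lookup_single)
  have edge: "edge_ideal u v (Suc n) = ideal_prod poly4_ring (?M n) ?E"
    using Suc by (simp add: edge_ideal_def ideals_set_def)
  have prod_ideal: "ideal (ideal_prod poly4_ring (?M n) ?E) poly4_ring"
    by (rule ideal_prod_is_ideal[OF ideal_M E])
  show ?case unfolding edge
  proof (intro equalityI subsetI)
    fix f assume "f \<in> ideal_prod poly4_ring (?M n) ?E"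
    then show "f \<in> ?M (Suc n)"
    proof induction
      case (prod i j)
      then show ?case using \<open>?E \<subseteq> ?M 1\<close>
        by (auto intro!: monomial_ideal_mult[of "\<lambda>t. n \<le> lk t u + lk t v"
              "\<lambda>t. 1 \<le> lk t u + lk t v"] simp: lookup_add)
    qed (simp add: monomial_ideal_add)
  next
    have step: "Poly_Mapping.single t c \<in> ideal_prod poly4_ring (?M n) ?E"
      if "z \<in> {u, v}" "lk t z \<noteq> 0" "Suc n \<le> lk t u + lk t v" for t z c
    proof -
      let ?e = "Poly_Mapping.single z 1 :: coord \<Rightarrow>\<^sub>0 nat"
      \<comment> \<open>Subtraction of exponents is truncated; it is undone here because
        \<open>z\<close> occurs in \<open>t\<close>.\<close>
      have "t - ?e + ?e = t"
        using that by (intro poly_mapping_eqI)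
          (auto simp: lookup_add lookup_minus lookup_single when_def)
      then have "Poly_Mapping.single t c = Poly_Mapping.single (t - ?e) c * var z"
        by (simp add: var_def mult_single)
      moreover have "Poly_Mapping.single (t - ?e) c \<in> ?M n"
        using that \<open>u \<noteq> v\<close> by (intro mono_in_monomial_ideal)
          (auto simp: lookup_minus lookup_single when_def)
      moreover have "var z \<in> ?E"
        using genideal_self[of "{var u, var v}"] that by auto
      ultimately show ?thesis
        using ideal_prod.prod[of "Poly_Mapping.single (t - ?e) c" "?M n" "var z" ?E poly4_ring] by simp
    qed
    fix f assume f: "f \<in> ?M (Suc n)"
    show "f \<in> ideal_prod poly4_ring (?M n) ?E"
    proof (rule poly_mapping_induct_terms[where Q = "\<lambda>g. g \<in> ideal_prod poly4_ring (?M n) ?E"])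
      show "0 \<in> ideal_prod poly4_ring (?M n) ?E"
        using additive_subgroup.zero_closed[OF ideal.axioms(1)[OF prod_ideal]] by simp
      show "g + h \<in> ideal_prod poly4_ring (?M n) ?E"
        if "g \<in> ideal_prod poly4_ring (?M n) ?E" "h \<in> ideal_prod poly4_ring (?M n) ?E" for g h
        using ideal_prod.sum[OF that] by simp
      fix t assume "lk f t \<noteq> 0"
      then have "Suc n \<le> lk t u + lk t v" using monomial_idealD[OF f] by blast
      then show "Poly_Mapping.single t (lk f t) \<in> ideal_prod poly4_ring (?M n) ?E"
        using step[of u t] step[of v t] by (cases "lk t u = 0") auto
    qed
  qed
qed

section \<open>Prime ideals generated by variables\<close>

definition restr :: "coord set \<Rightarrow> 'k::field poly4 \<Rightarrow> 'k poly4" where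
  "restr U = Poly_Mapping.mapp (\<lambda>t c. c when (\<forall>u\<in>U. lk t u = 0))"

lemma lookup_restr: "lk (restr U f) t = (lk f t when (\<forall>u\<in>U. lk t u = 0))"
  by (simp add: restr_def lookup_mapp when_def in_keys_iff)

text \<open>\<open>restr U\<close> substitutes 0 for the variables in \<open>U\<close>. It is
  multiplicative because a sum of exponents avoids \<open>U\<close> exactly when both summands
  do.\<close>

lemma restr_mult: "restr U (f * g) = restr U f * restr U g"
proof (rule poly_mapping_eqI)
  fix t
  let ?Z = "\<lambda>t :: coord \<Rightarrow>\<^sub>0 nat. \<forall>u\<in>U. lk t u = 0"
  have Z: "?Z (l + q) \<longleftrightarrow> ?Z l \<and> ?Z q" for l q by (auto simp: lookup_add)
  have inner: "(lk f l * (\<Sum>q. lk g q when t = l + q) when ?Z t)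
     = lk (restr U f) l * (\<Sum>q. lk (restr U g) q when t = l + q)" for l
  proof (cases "?Z l")
    case True
    then have "((lk g q when t = l + q) when ?Z t) = (lk (restr U g) q when t = l + q)" for q
      using Z[of l q] by (auto simp: when_def lookup_restr)
    then show ?thesis using True
      by (simp add: lookup_restr flip: mult_when Sum_any_when_independent)
  next
    case False
    then have "((lk g q when t = l + q) when ?Z t) = 0" for q
      using Z[of l q] by (auto simp: when_def)
    then have "((\<Sum>q. lk g q when t = l + q) when ?Z t) = 0"
      by (simp flip: Sum_any_when_independent)
    then have "(lk f l * (\<Sum>q. lk g q when t = l + q) when ?Z t) = 0"
      by (simp flip: mult_when)
    then show ?thesis using False by (simp add: lookup_restr)
  qed
  have "lk (restr U (f * g)) t = (\<Sum>l. lk f l * (\<Sum>q. lk g q when t = l + q) when ?Z t)"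
    by (simp add: lookup_restr lookup_mult Sum_any_when_independent)
  also have "\<dots> = lk (restr U f * restr U g) t"
    unfolding lookup_mult using inner by simp
  finally show "lk (restr U (f * g)) t = lk (restr U f * restr U g) t" .
qed

abbreviation coord_prime :: "coord set \<Rightarrow> 'k::field poly4 set" where
  "coord_prime U \<equiv> monomial_ideal (\<lambda>t. \<exists>u\<in>U. lk t u \<noteq> 0)"

lemma in_coord_prime_iff: "f \<in> coord_prime U \<longleftrightarrow> restr U f = 0"
proof
  assume "f \<in> coord_prime U"
  then show "restr U f = 0"
    by (intro poly_mapping_eqI)
          (auto simp: lookup_restr when_def dest: monomial_idealD)
next
  assume f: "restr U f = 0"
  show "f \<in> coord_prime U"
  proof (rule monomial_idealI, rule ccontr)
    fix t assume "lk f t \<noteq> 0" "\<not> (\<exists>u\<in>U. lk t u \<noteq> 0)"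
    then have "lk (restr U f) t \<noteq> 0" by (simp add: lookup_restr)
    then show False by (simp add: f)
  qed
qed

lemma one_notin_coord_prime: "1 \<notin> coord_prime U"
  by (simp add: monomial_ideal_def)

text \<open>\<open>coord_prime U\<close> is the kernel of the multiplicative map
  \<open>restr U\<close>, and the polynomial ring has no zero divisors. This is where the linear
  order on \<open>coord\<close> enters.\<close>

lemma primeideal_coord_prime: "primeideal (coord_prime U :: 'k::field poly4 set) poly4_ring"
proof (rule primeidealI)
  show "ideal (coord_prime U :: 'k poly4 set) poly4_ring"
    by (rule ideal_monomial_ideal) (auto simp: lookup_add)
  show "carrier poly4_ring \<noteq> (coord_prime U :: 'k poly4 set)"
  proof
    assume "carrier poly4_ring = (coord_prime U :: 'k poly4 set)"
    then have "(1 :: 'k poly4) \<in> coord_prime U" by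
      (simp only: poly4_ring_simps) (rule subst, assumption, rule UNIV_I)
    then show False by (rule notE[OF one_notin_coord_prime])
  qed
  show "f \<in> coord_prime U \<or> g \<in> coord_prime U"
    if "f \<otimes>\<^bsub>poly4_ring\<^esub> g \<in> coord_prime U" for f g :: "'k poly4"
    using that unfolding poly4_ring_simps in_coord_prime_iff restr_mult by simp
qed (rule cring_poly4)

text \<open>A polynomial outside \<open>coord_prime UNIV\<close> has a nonzero constant term
  \<open>c\<close>. A larger ideal \<open>J\<close> contains both this polynomial and its part
  without constant term, hence the unit \<open>c\<close>.\<close>

lemma maximalideal_coord_prime: "maximalideal (coord_prime UNIV :: 'k::field poly4 set) poly4_ring"
proof (rule maximalidealI)
  let ?m = "coord_prime UNIV :: 'k poly4 set"
  interpret m: primeideal ?m poly4_ring by (rule primeideal_coord_prime)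
  show "ideal ?m poly4_ring" by (rule m.is_ideal)
  show "carrier poly4_ring \<noteq> ?m" by (rule m.I_notcarr)
  fix J :: "'k poly4 set" assume J: "ideal J poly4_ring" "?m \<subseteq> J" "J \<subseteq> carrier poly4_ring"
  interpret J: ideal J poly4_ring by fact
  show "J = ?m \<or> J = carrier poly4_ring"
  proof (cases "J = ?m")
    case False
    then obtain f where f: "f \<in> J" "f \<notin> ?m" using J by blast
    define c where "c = lk f 0"
    have "f - Poly_Mapping.single 0 c \<in> ?m"
    proof (rule monomial_idealI)
      fix t assume "lk (f - Poly_Mapping.single 0 c) t \<noteq> 0"
      then have "t \<noteq> 0" by (auto simp: c_def lookup_minus)
      then obtain u where "lk t u \<noteq> 0" using poly_mapping_eqI[of t 0] by auto
      then show "\<exists>u\<in>UNIV. lk t u \<noteq> 0" by blast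
    qed
    then have "- (f - Poly_Mapping.single 0 c) \<in> J"
      using J.a_inv_closed[of "f - Poly_Mapping.single 0 c"] J(2) unfolding poly4_uminus by blast
    then have "f - (f - Poly_Mapping.single 0 c) \<in> J"
      using J.a_closed[OF f(1)] by fastforce
    then have "Poly_Mapping.single 0 c \<in> J" by simp
    then have "Poly_Mapping.single 0 (1 / c) * Poly_Mapping.single 0 c \<in> J"
      using J.I_l_closed by fastforce
    moreover have "c \<noteq> 0"
    proof
      assume "c = 0"
      then have "f - Poly_Mapping.single 0 c = f" by simp
      then show False using f \<open>f - Poly_Mapping.single 0 c \<in> ?m\<close> by simp
    qed
    ultimately have "1 \<in> J" by (simp add: mult_single)
    then show ?thesis using J.one_imp_carrier by simp
  qed simp
qed

section \<open>Depth and codimension at the irrelevant ideal\<close>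

lemma lookup_single_mult:
  fixes s :: "'a::cancel_comm_monoid_add"
  shows "lk (Poly_Mapping.single s c * f) (s + t) = c * lk f t"
proof -
  have "lk (Poly_Mapping.single s c) l * (\<Sum>q. lk f q when s + t = l + q)
      = (c * lk f t when l = s)" for l
    by (cases "l = s") (simp_all add: lookup_single lookup_single_not_eq)
  then show ?thesis by (simp add: lookup_mult)
qed

lemma ideal_poly4D:
  assumes "ideal I (poly4_ring :: 'k::field poly4 ring)"
  shows "f \<in> I \<Longrightarrow> g \<in> I \<Longrightarrow> f + g \<in> I" "f \<in> I \<Longrightarrow> g \<in> I \<Longrightarrow> f - g \<in> I" "f \<in> I \<Longrightarrow> g * f \<in> I"
proof -
  interpret ideal I "poly4_ring :: 'k poly4 ring" by fact
  show add: "f + g \<in> I" if "f \<in> I" "g \<in> I" for f g 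
    using additive_subgroup.a_closed[OF ideal.axioms(1)[OF assms] that] by simp
  show mult: "g * f \<in> I" if "f \<in> I" for f g using I_l_closed[OF that, of g] by simp
  show "f - g \<in> I" if "f \<in> I" "g \<in> I" for f g using add[OF that(1) mult[OF that(2), of "-1"]] by simp
qed

text \<open>Regularity would produce a polynomial \<open>h\<close> with \<open>s h = s e\<close> in
  the quotient for every \<open>s\<close> in the irrelevant ideal. The products with
  \<open>u\<close> and with \<open>x\<close> then force the coefficient of \<open>h\<close> at
  \<open>a\<close> to be both 0 and 1.\<close>

lemma no_regular_sequence_of_length_2:
  fixes P :: "(coord \<Rightarrow>\<^sub>0 nat) \<Rightarrow> bool" and m n :: nat and u v x y :: coord
  defines "I \<equiv> monomial_ideal (\<lambda>t. m \<le> lk t u + lk t v \<and> n \<le> lk t x + lk t y \<and> P t) :: 'k::field poly4 set"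
  assumes dist: "distinct [u, v, x, y]"
    and P: "\<And>s t. P t \<Longrightarrow> P (s + t)" "P a"
    and m: "m = Suc (lk a u + lk a v)" and n: "n = Suc (lk a x + lk a y)"
    and reg: "regular_sequence (poly4_ring Quot I) (A # B # Z)"
    and AB: "A \<in> a_r_coset poly4_ring I ` coord_prime UNIV"
      "B \<in> a_r_coset poly4_ring I ` coord_prime UNIV"
  shows False
proof -
  interpret cring "poly4_ring :: 'k poly4 ring" by (rule cring_poly4)
  have UNIV: "z \<in> {u, v, x, y}" for z
  proof -
    have eq: "(UNIV :: coord set) = {coord_a, coord_b, coord_c, coord_d}"
      by (auto intro: coord.exhaust)
    have "finite (UNIV :: coord set)" "card (UNIV :: coord set) = 4"
      unfolding eq by simp_all
    then have "{u, v, x, y} = UNIV"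
      using dist by (intro card_subset_eq) simp_all
    then show ?thesis by blast
  qed
  have I: "ideal I poly4_ring"
    unfolding I_def by (rule ideal_monomial_ideal) (auto simp: lookup_add intro: P)
  note I_closed = ideal_poly4D[OF I]
  \<comment> \<open>With \<open>e\<close> as at the top, \<open>s e\<close> is the class of \<open>lo s * w\<close> for every \<open>s\<close> in the
    irrelevant ideal.\<close>
  define w where "w = (Poly_Mapping.single a 1 :: 'k poly4)"
  define lo where "lo = (restr {u, v} :: 'k poly4 \<Rightarrow> _)"
  define hi where "hi s = s - lo s" for s
  have hi: "hi s \<in> coord_prime {u, v}" for s
    by (rule monomial_idealI) (auto simp: hi_def lo_def lookup_minus lookup_restr when_def split: if_splits)
  have lo: "lo s \<in> coord_prime {x, y}" if "s \<in> coord_prime UNIV" for s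
  proof (rule monomial_idealI)
    fix t assume "lk (lo s) t \<noteq> 0"
    then have "lk s t \<noteq> 0" "\<forall>z\<in>{u, v}. lk t z = 0"
      by (auto simp: lo_def lookup_restr when_def split: if_splits)
    moreover from this obtain z where "lk t z \<noteq> 0"
      using monomial_idealD[OF \<open>s \<in> coord_prime UNIV\<close>] by blast
    ultimately show "\<exists>z\<in>{x, y}. lk t z \<noteq> 0" using UNIV[of z] by auto
  qed
  \<comment> \<open>A factor from \<open>(u,v)\<close> and a factor from \<open>(x,y)\<close> each
    supply the one degree that \<open>w\<close> lacks, so the product lies in
    \<open>I\<close>.\<close>
  have hi_lo: "hi p * lo q * w \<in> I" if "q \<in> coord_prime UNIV" for p q
  proof -
    have "hi p * lo q \<in> monomial_ideal (\<lambda>t. 0 < lk t u + lk t v \<and> 0 < lk t x + lk t y)"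
      by (rule monomial_ideal_mult[OF _ hi lo[OF that]]) (auto simp: lookup_add)
    moreover have "w \<in> monomial_ideal (\<lambda>t. t = a)"
      unfolding w_def by (rule mono_in_monomial_ideal) simp
    ultimately show ?thesis unfolding I_def
      by (rule monomial_ideal_mult[rotated]) (auto simp: lookup_add m n intro: P)
  qed
  \<comment> \<open>This is \<open>p (q e) = q (p e)\<close>, written on representatives. Splitting
    \<open>p\<close> and \<open>q\<close> into \<open>hi\<close> and \<open>lo\<close> cancels the
    common term \<open>lo p * lo q\<close>.\<close>
  have cross: "(p * lo q - q * lo p) * w \<in> I"
    if "p \<in> coord_prime UNIV" "q \<in> coord_prime UNIV" for p q
  proof -
    have "(p * lo q - q * lo p) * w = hi p * lo q * w - hi q * lo p * w"
      by (simp add: hi_def algebra_simps)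
    then show ?thesis using that by (simp add: I_closed hi_lo)
  qed
  obtain f g where f: "f \<in> coord_prime UNIV" "A = I +>\<^bsub>poly4_ring\<^esub> f"
    and g: "g \<in> coord_prime UNIV" "B = I +>\<^bsub>poly4_ring\<^esub> g"
    using AB by blast
  note regular = regular_sequence_quotD[OF I reg[unfolded f g], simplified]
  have "g * (lo f * w) - f * (lo g * w) \<in> I"
    using cross[OF g(1) f(1)] by (simp add: algebra_simps)
  \<comment> \<open>The element \<open>g (f e) = f (g e)\<close> is a multiple of \<open>f\<close>
    in the quotient. As \<open>g\<close> is regular modulo \<open>f\<close>, so is
    \<open>f e\<close> itself, say \<open>f e = f h\<close>.\<close>
  then obtain h where h: "lo f * w - f * h \<in> I" using regular(2) by blast
  \<comment> \<open>That is, \<open>f (e - h) = 0\<close>; since \<open>f\<close> is regular this forces \<open>s (e - h) = 0\<close> for all \<open>s\<close>.\<close>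
  have *: "lo s * w - s * h \<in> I" if "s \<in> coord_prime UNIV" for s
  proof -
    have "f * (lo s * w - s * h) = s * (lo f * w - f * h) + (f * lo s - s * lo f) * w"
      by (simp add: algebra_simps)
    also have "\<dots> \<in> I" by (rule I_closed(1)[OF I_closed(3)[OF h] cross[OF f(1) that]])
    finally show ?thesis by (rule regular(1))
  qed
  have var: "var z \<in> coord_prime UNIV" for z
    unfolding var_def by (rule mono_in_monomial_ideal) (auto simp: lookup_single intro!: exI[of _ z])
  have lo_u: "lo (var u) = 0"
    by (rule poly_mapping_eqI) (auto simp: lo_def var_def lookup_restr lookup_single when_def)
  have lo_x: "lo (var x) = var x"
    using dist by (intro poly_mapping_eqI)
          (auto simp: lo_def var_def lookup_restr lookup_single when_def)
  let ?e = "\<lambda>z. Poly_Mapping.single z 1 :: coord \<Rightarrow>\<^sub>0 nat"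
  have outside: "lk p t = 0" if "p \<in> I" "lk t u + lk t v < m \<or> lk t x + lk t y < n" for p t
  proof (rule ccontr)
    assume "lk p t \<noteq> 0"
    from monomial_idealD[OF that(1)[unfolded I_def] this] that(2) show False by linarith
  qed
  \<comment> \<open>Multiplying by \<open>u\<close> leaves the degree of \<open>a\<close> in
    \<open>x\<close> and \<open>y\<close> at \<open>n - 1\<close>, so no element of \<open>I\<close>
    has a term there. As \<open>u e = 0\<close>, the coefficient of \<open>h\<close> at
    \<open>a\<close> vanishes.\<close>
  have "lk (lo (var u) * w - var u * h) (?e u + a) = 0"
    using dist by (intro outside[OF *[OF var]]) (simp add: lookup_add lookup_single n)
  then have "lk h a = 0" unfolding lo_u unfolding var_def by (simp add: lookup_single_mult lookup_minus)
  \<comment> \<open>Likewise \<open>x\<close> leaves the degree in \<open>u\<close> and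
    \<open>v\<close> at \<open>m - 1\<close>. Here \<open>x e = x w\<close>, so \<open>h\<close> and
    \<open>w\<close> have the same coefficient at \<open>a\<close>.\<close>
  have "lk (lo (var x) * w - var x * h) (?e x + a) = 0"
    using dist by (intro outside[OF *[OF var]]) (auto simp: lookup_add lookup_single when_def m)
  then have "lk w a = lk h a" unfolding lo_x unfolding var_def by (simp add: lookup_single_mult lookup_minus)
  with \<open>lk h a = 0\<close> show False by (simp add: w_def)
qed

lemma not_cohen_macaulay_monomial_quot:
  fixes P :: "(coord \<Rightarrow>\<^sub>0 nat) \<Rightarrow> bool" and m n :: nat and u v x y :: coord
  defines "I \<equiv> monomial_ideal (\<lambda>t. m \<le> lk t u + lk t v \<and> n \<le> lk t x + lk t y \<and> P t) :: 'k::field poly4 set"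
  assumes dist: "distinct [u, v, x, y]"
    and P: "\<And>s t. P t \<Longrightarrow> P (s + t)" "P a"
    and m: "m = Suc (lk a u + lk a v)" and n: "n = Suc (lk a x + lk a y)"
  shows "\<not> cohen_macaulay (poly4_ring Quot I)"
proof
  assume CM: "cohen_macaulay (poly4_ring Quot I)"
  interpret cring "poly4_ring :: 'k poly4 ring" by (rule cring_poly4)
  define q where "q U = a_r_coset poly4_ring I ` coord_prime U" for U
  have I: "ideal I poly4_ring"
    unfolding I_def by (rule ideal_monomial_ideal) (auto simp: lookup_add intro: P)
  have sub: "I \<subseteq> coord_prime U" if "{u, v} \<subseteq> U" for U
  proof
    fix f assume f: "f \<in> I"
    show "f \<in> coord_prime U"
    proof (rule monomial_idealI)
      fix t assume "lk f t \<noteq> 0"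
      then have "m \<le> lk t u + lk t v" using monomial_idealD f unfolding I_def by blast
      \<comment> \<open>\<open>m\<close> is a successor, hence positive, so every term of an element
        of \<open>I\<close> involves \<open>u\<close> or \<open>v\<close>.\<close>
      then have "lk t u \<noteq> 0 \<or> lk t v \<noteq> 0" using m by auto
      then show "\<exists>z\<in>U. lk t z \<noteq> 0" using that by blast
    qed
  qed
  have "length xs \<le> 1" if xs: "regular_sequence (poly4_ring Quot I) xs" "set xs \<subseteq> q UNIV" for xs
  proof (rule ccontr)
    assume "\<not> length xs \<le> 1"
    then obtain A B Z where "xs = A # B # Z" by (cases xs; cases "tl xs") auto
    then have AB: "regular_sequence (poly4_ring Quot I) (A # B # Z)" "A \<in> q UNIV" "B \<in> q UNIV"
      using xs by auto
    show False
      by (rule no_regular_sequence_of_length_2[OF dist P m n AB[unfolded q_def I_def]])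
  qed
  then have depth: "ideal_depth (poly4_ring Quot I) (q UNIV) \<le> 1"
    unfolding ideal_depth_def by (intro Sup_least) (auto simp: one_enat_def)
  have prime: "primeideal (q U) (poly4_ring Quot I)" if "{u, v} \<subseteq> U" for U
    unfolding q_def by (rule primeideal_image_quot[OF I primeideal_coord_prime sub[OF that]])
  have less: "q U \<subset> q V" if "{u, v} \<subseteq> U" "U \<subseteq> V" "z \<in> V" "z \<notin> U" for U V z
  proof
    have "coord_prime U \<subseteq> (coord_prime V :: 'k poly4 set)"
      using \<open>U \<subseteq> V\<close> unfolding monomial_ideal_def by blast
    then show "q U \<subseteq> q V" unfolding q_def by blast
    have "var z \<in> (coord_prime V :: 'k poly4 set)"
      unfolding var_def using that(3) by (intro mono_in_monomial_ideal bexI[of _ z]) simp_all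
    then have "I +>\<^bsub>poly4_ring\<^esub> var z \<in> q V" unfolding q_def by blast
    moreover have "var z \<notin> (coord_prime U :: 'k poly4 set)"
      using that(4) by (auto simp: monomial_ideal_def var_def lookup_single when_def)
    then have "I +>\<^bsub>poly4_ring\<^esub> var z \<notin> q U"
      unfolding q_def
      using coset_in_image_iff[OF I primeideal.axioms(1)[OF primeideal_coord_prime] sub[OF that(1)],
          of "var z"]
      by simp
    ultimately show "q U \<noteq> q V" by blast
  qed
  \<comment> \<open>The chain starts at \<open>(u,v)\<close>, which contains \<open>I\<close>. The
    constant value from index 2 on keeps every \<open>p i\<close> prime.\<close>
  define p where "p i = q (if i = 0 then {u, v} else if i = 1 then {u, v, x} else UNIV)" for i :: nat
  have "enat 2 \<le> codimension (poly4_ring Quot I) (q UNIV)"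
    unfolding codimension_def
  proof (intro Sup_upper CollectI exI[of _ 2] exI[of _ p] conjI allI impI refl)
    show "primeideal (p i) (poly4_ring Quot I)" for i
      unfolding p_def by (rule prime) auto
    show "p i \<subset> p (Suc i)" if "i < 2" for i
      using that less[of "{u, v}" "{u, v, x}" x] less[of "{u, v, x}" UNIV y] dist
      by (auto simp: p_def less_2_cases_iff)
    show "p 2 = q UNIV" by (simp add: p_def)
  qed
  moreover have "maximalideal (q UNIV) (poly4_ring Quot I)"
    unfolding q_def by (rule maximalideal_image_quot[OF I maximalideal_coord_prime sub]) simp
  then have "ideal_depth (poly4_ring Quot I) (q UNIV) = codimension (poly4_ring Quot I) (q UNIV)"
    using CM unfolding cohen_macaulay_def by blast
  ultimately have "enat 2 \<le> 1" using depth by (simp only: order.trans)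
  then show False by (simp add: one_enat_def)
qed

section \<open>Tetrahedral curves with two long opposite edges\<close>

lemma not_cohen_macaulay_two_long_edges:
  fixes u v x y :: coord
  assumes dist: "distinct [u, v, x, y]"
    and "c + e < m" "d + f < m" "c + d < n" "e + f < n"
    and I: "I = edge_ideal u v m \<inter> edge_ideal x y n \<inter> edge_ideal u x c \<inter> edge_ideal u y d
      \<inter> edge_ideal v x e \<inter> edge_ideal v y f"
  shows "\<not> cohen_macaulay ((poly4_ring :: 'k::field poly4 ring) Quot I)"
proof -
  let ?P = "\<lambda>t. c \<le> lk t u + lk t x \<and> d \<le> lk t u + lk t y \<and> e \<le> lk t v + lk t x \<and> f \<le> lk t v + lk t y"
  \<comment> \<open>The monomial \<open>w\<close> avoids \<open>u\<close>, so \<open>x\<close> and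
    \<open>y\<close> must serve the edges \<open>ux\<close> and \<open>uy\<close>: total degree
    \<open>n - 1\<close> suffices because \<open>c + d < n\<close>. The power \<open>m - 1\<close>
    of \<open>v\<close> serves \<open>vx\<close> and \<open>vy\<close>, since \<open>e\<close> and
    \<open>f\<close> are below \<open>m\<close>.\<close>
  let ?a = "Poly_Mapping.single v (m - 1) + Poly_Mapping.single x c + Poly_Mapping.single y (n - 1 - c)"
  have "I = monomial_ideal (\<lambda>t. m \<le> lk t u + lk t v \<and> n \<le> lk t x + lk t y \<and> ?P t)"
    using dist unfolding I by (simp add: edge_ideal_eq monomial_ideal_Int conj_assoc)
  moreover have "\<not> cohen_macaulay ((poly4_ring :: 'k poly4 ring) Quot \<dots>)"
    using assms by (intro not_cohen_macaulay_monomial_quot[OF dist, where a = ?a])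
      (auto simp: lookup_add lookup_single when_def)
  ultimately show ?thesis by simp
qed

lemma edge_ideal_commute: "edge_ideal u v = edge_ideal v u"
  by (simp add: edge_ideal_def insert_commute fun_eq_iff)

theorem corollary4p3:
  fixes C :: tetrahedral_curve
  assumes "S_minimal C"
  shows "arithmetically_CM TYPE('k::field) C \<longleftrightarrow> trivial_curve C"
proof (cases "trivial_curve C")
  case True
  then show ?thesis by (simp add: arithmetically_CM_def)
next
  case False
  obtain a1 a2 a3 a4 a5 a6 where C: "C = (a1, a2, a3, a4, a5, a6)" by (cases C)
  have "\<not> system_A C" "\<not> system_B C" "\<not> system_C C" "\<not> system_D C"
    using assms False by (auto simp: S_minimal_def)
  \<comment> \<open>Each failing system gives, for its vertex, a triangle through it in which the
    edge opposite the vertex exceeds the sum of the other two. A triangle has at most one such edge,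
    so different vertices give different triangles, and sending a vertex to the corner its triangle
    omits is a permutation without fixed points. A 4-cycle would give a cyclic chain of strict
    inequalities between four edges; the three products of two disjoint transpositions are the cases
    below.\<close>
  then consider
      "a2 + a4 < a1" "a3 + a5 < a1" "a2 + a3 < a6" "a4 + a5 < a6"
    | "a1 + a4 < a2" "a3 + a6 < a2" "a1 + a3 < a5" "a4 + a6 < a5"
    | "a1 + a5 < a3" "a2 + a6 < a3" "a1 + a2 < a4" "a5 + a6 < a4"
    unfolding C system_A.simps system_B.simps system_C.simps system_D.simps de_Morgan_conj not_le
    by (elim disjE) simp_all
  then have "\<not> cohen_macaulay ((poly4_ring :: 'k poly4 ring) Quot curve_ideal C)"
  proof cases
    case 1
    then show ?thesis unfolding C
      by (intro not_cohen_macaulay_two_long_edges[of coord_a coord_b coord_c coord_d a2 a4 a1 a3 a5 a6])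
        auto
  next
    case 2
    then show ?thesis unfolding C
      by (intro not_cohen_macaulay_two_long_edges[of coord_a coord_c coord_b coord_d a1 a4 a2 a3 a6 a5])
        (auto simp: edge_ideal_commute[of coord_c coord_b])
  next
    case 3
    then show ?thesis unfolding C
      by (intro not_cohen_macaulay_two_long_edges[of coord_a coord_d coord_b coord_c a1 a5 a3 a2 a6 a4])
        (auto simp: edge_ideal_commute[of coord_d])
  qed
  then show ?thesis using False by (simp add: arithmetically_CM_def)
qed

end
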